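(* Let $\mathcal{A}$ be an algebra over a field of characteristic zero, and let $\{f_n\}_{n\ge 0}$ be a higher $\{g_n,h_n\}$-derivation on $\mathcal{A}$ (with associated sequences of linear maps $\{g_n\}_{n\ge 0}$, $\{h_n\}_{n\ge 0}$ on $\mathcal{A}$) such that $f_0=g_0=h_0=I$. Then there are sequences $\{F_n\}_{n\ge 1}$, $\{G_n\}_{n\ge 1}$, $\{H_n\}_{n\ge 1}$ of linear maps $\mathcal{A}\to\mathcal{A}$ such that $F_n$ is a $\{G_n,H_n\}$-derivation for every $n\ge 1$ and, for every positive integer $n$, $$f_n=\sum_{i=1}^{n}\ \sum_{r_1+\cdots+r_i=n}\Big(\prod_{j=1}^{i}\frac{1}{r_j+\cdots+r_i}\Big)F_{r_1}\cdots F_{r_i},$$ $$g_n=\sum_{i=1}^{n}\ \sum_{r_1+\cdots+r_i=n}\Big(\prod_{j=1}^{i}\frac{1}{r_j+\cdots+r_i}\Big)G_{r_1}\cdots G_{r_i},$$ $$h_n=\sum_{i=1}^{n}\ \sum_{r_1+\cdots+r_i=n}\Big(\prod_{j=1}^{i}\frac{1}{r_j+\cdots+r_i}\Big)H_{r_1}\cdots H_{r_i},$$ where each inner sum is taken over all $i$-tuples $(r_1,\dots,r_i)$ of positive integers with $\sum_{j=1}^{i}r_j=n$, and products of maps denote composition.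
   Context: $I$ denotes the identity map on $\mathcal{A}$; the algebra is not assumed to be unital. For linear maps $f,g,h:\mathcal{A}\to\mathcal{A}$, $f$ is called a $\{g,h\}$-derivation if $f(ab)=g(a)b+ah(b)=h(a)b+ag(b)$ for all $a,b\in\mathcal{A}$. A sequence $\{f_n\}_{n\ge 0}$ of linear maps on $\mathcal{A}$ is called a higher $\{g_n,h_n\}$-derivation if $\{g_n\}_{n\ge 0}$ and $\{h_n\}_{n\ge 0}$ are sequences of linear maps on $\mathcal{A}$ such that $$f_n(ab)=\sum_{k=0}^{n}g_{n-k}(a)h_k(b)=\sum_{k=0}^{n}h_{n-k}(a)g_k(b)$$ for all $a,b\in\mathcal{A}$ and every non-negative integer $n$. *)

theory Defs
  imports Complex_Main
begin

text \<open>
  Associative algebras over a field. No unit is assumed: the class \<^class>\<open>ring\<close> does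
  not require one.
\<close>

locale algebra_over_field = vector_space scale
  for scale :: "'k::field \<Rightarrow> 'a::ring \<Rightarrow> 'a" (infixr \<open>*s\<close> 75) +
  assumes mult_scale_left: "(c *s a) * b = c *s (a * b)"
    and mult_scale_right: "a * (c *s b) = c *s (a * b)"

definition gh_derivation ::
    "('k::field \<Rightarrow> 'a::ring \<Rightarrow> 'a) \<Rightarrow> ('a \<Rightarrow> 'a) \<Rightarrow> ('a \<Rightarrow> 'a) \<Rightarrow> ('a \<Rightarrow> 'a) \<Rightarrow> bool" where
  "gh_derivation scale g h f \<longleftrightarrow>
     Vector_Spaces.linear scale scale f \<and>
     Vector_Spaces.linear scale scale g \<and>
     Vector_Spaces.linear scale scale h \<and>
     (\<forall>a b. f (a * b) = g a * b + a * h b \<and> f (a * b) = h a * b + a * g b)"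

definition higher_gh_derivation ::
    "('k::field \<Rightarrow> 'a::ring \<Rightarrow> 'a) \<Rightarrow> (nat \<Rightarrow> 'a \<Rightarrow> 'a) \<Rightarrow> (nat \<Rightarrow> 'a \<Rightarrow> 'a) \<Rightarrow> (nat \<Rightarrow> 'a \<Rightarrow> 'a) \<Rightarrow> bool" where
  "higher_gh_derivation scale g h f \<longleftrightarrow>
     (\<forall>n. Vector_Spaces.linear scale scale (f n)) \<and>
     (\<forall>n. Vector_Spaces.linear scale scale (g n)) \<and>
     (\<forall>n. Vector_Spaces.linear scale scale (h n)) \<and>
     (\<forall>n a b. f n (a * b) = (\<Sum>k=0..n. g (n - k) a * h k b) \<and>
              f n (a * b) = (\<Sum>k=0..n. h (n - k) a * g k b))"

text \<open>A tuple \<open>(r\<^sub>1, \<dots>, r\<^sub>i)\<close> is the list \<open>[r\<^sub>1, \<dots>, r\<^sub>i]\<close>.\<close>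

definition positive_tuples :: "nat \<Rightarrow> nat \<Rightarrow> nat list set" where
  "positive_tuples i n = {rs. length rs = i \<and> (\<forall>r\<in>set rs. 0 < r) \<and> sum_list rs = n}"

lemma finite_positive_tuples: "finite (positive_tuples i n)"
proof (rule finite_subset)
  show "positive_tuples i n \<subseteq> {rs. set rs \<subseteq> {..n} \<and> length rs = i}"
    by (auto simp: positive_tuples_def member_le_sum_list)
  show "finite {rs. set rs \<subseteq> {..n} \<and> length rs = i}"
    by (rule finite_lists_length_eq) simp
qed

text \<open>
  For \<open>rs = [r\<^sub>1, \<dots>, r\<^sub>i]\<close>, the sum \<open>r\<^sub>j + \<dots> + r\<^sub>i\<close> is \<open>sum_list (drop (j - 1) rs)\<close>, and
  \<open>foldr (\<circ>) (map D rs) id\<close> is the composite \<open>D r\<^sub>1 \<circ> \<dots> \<circ> D r\<^sub>i\<close>, so \<open>D r\<^sub>i\<close> is applied first.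
\<close>

definition weighted_composition_sum ::
    "('k::field \<Rightarrow> 'a::ring \<Rightarrow> 'a) \<Rightarrow> (nat \<Rightarrow> 'a \<Rightarrow> 'a) \<Rightarrow> nat \<Rightarrow> 'a \<Rightarrow> 'a" where
  "weighted_composition_sum scale D n x =
     (\<Sum>i=1..n. \<Sum>rs\<in>positive_tuples i n.
        scale (\<Prod>j=1..i. 1 / of_nat (sum_list (drop (j - 1) rs)))
              (foldr (\<circ>) (map D rs) id x))"

end

theory Submission
  imports Defs
begin

text \<open>
  Collect a sequence of maps into the formal power series \<open>f(t) = \<Sum>n. f\<^sub>n t\<^sup>n\<close>, whose
  coefficients multiply by composition. Since \<open>f\<^sub>0 = id\<close>, it is invertible and has a
  logarithmic derivative \<open>F(t) = t f'(t) f(t)\<^sup>-\<^sup>1\<close>, whose coefficients are determined by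
  \[ n f_n = \sum_{k=1}^{n} F_k f_{n-k}. \]
  The maps \<open>F\<close>, \<open>G\<close>, \<open>H\<close> of the theorem are the logarithmic derivatives of \<open>f\<close>, \<open>g\<close>, \<open>h\<close>.

  They are derivation triples by the Leibniz rule for \<open>t d/dt\<close>. The hypothesis says
  \<open>f(t)(a b) = g(t)(a) h(t)(b)\<close>; applying \<open>t d/dt\<close> gives
  \[ F(t)(g(t)(a)\, h(t)(b)) = G(t)(g(t)(a))\, h(t)(b) + g(t)(a)\, H(t)(h(t)(b)), \]
  and as \<open>g(t)\<close> and \<open>h(t)\<close> are invertible their values can be replaced by \<open>a\<close> and \<open>b\<close>.
  On coefficients this replacement is a strong induction: all terms with index below \<open>n\<close>
  cancel, and what remains is the derivation rule for \<open>F\<^sub>n\<close>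
  (\<open>log_derivative_leibniz\<close>).

  Conversely, in characteristic zero one can divide the recursion by \<open>n\<close>, so it determines
  \<open>f\<close> from \<open>F\<close>. The weighted sum over compositions of \<open>n\<close> satisfies the same recursion:
  removing the first part \<open>r\<^sub>1\<close> of a composition splits off the map \<open>F\<^bsub>r\<^sub>1\<^esub>\<close> on the left and
  the factor \<open>1 / (r\<^sub>1 + \<dots> + r\<^sub>i) = 1 / n\<close>, and leaves a composition of \<open>n - r\<^sub>1\<close> with its own
  weight (\<open>composition_sum_rec\<close>). Hence it equals \<open>f\<^sub>n\<close>.
\<close>

section \<open>Compositions of a natural number\<close>

definition compositions :: "nat \<Rightarrow> nat list set" where
  "compositions n = {rs. (\<forall>r\<in>set rs. 0 < r) \<and> sum_list rs = n}"

lemma length_le_sum_list_if_positive: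
  fixes rs :: "nat list"
  assumes "\<forall>r\<in>set rs. 0 < r"
  shows "length rs \<le> sum_list rs"
  using assms by (induction rs) auto

lemma compositions_eq_positive_tuples: "compositions n = (\<Union>i\<in>{0..n}. positive_tuples i n)"
  using length_le_sum_list_if_positive
  by (auto simp: compositions_def positive_tuples_def)

lemma finite_compositions: "finite (compositions n)"
  unfolding compositions_eq_positive_tuples using finite_positive_tuples by blast

lemma compositions_0: "compositions 0 = {[]}"
proof -
  have "rs = []" if "rs \<in> compositions 0" for rs
    using that by (cases rs) (auto simp: compositions_def)
  then show ?thesis
    by (auto simp: compositions_def)
qed

lemma sum_compositions_Cons:
  fixes T :: "nat list \<Rightarrow> 'a::comm_monoid_add"
  assumes "n \<ge> 1"
  shows "(\<Sum>rs\<in>compositions n. T rs) = (\<Sum>k=1..n. \<Sum>rs\<in>compositions (n - k). T (k # rs))"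
proof -
  have "(\<Sum>rs\<in>compositions n. T rs)
      = (\<Sum>(k, rs)\<in>(SIGMA k:{1..n}. compositions (n - k)). T (k # rs))"
  proof (rule sum.reindex_bij_witness[where i = "\<lambda>(k, rs). k # rs" and j = "\<lambda>rs. (hd rs, tl rs)"])
    fix rs assume "rs \<in> compositions n"
    then show "(case (hd rs, tl rs) of (k, rs) \<Rightarrow> k # rs) = rs"
      and "(hd rs, tl rs) \<in> (SIGMA k:{1..n}. compositions (n - k))"
      and "(case (hd rs, tl rs) of (k, rs) \<Rightarrow> T (k # rs)) = T rs"
      using assms by (cases rs; auto simp: compositions_def)+
  qed (auto simp: compositions_def)
  also have "\<dots> = (\<Sum>k=1..n. \<Sum>rs\<in>compositions (n - k). T (k # rs))"
    by (rule sum.Sigma[symmetric]) (auto simp: finite_compositions)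
  finally show ?thesis .
qed

definition tail_sum_weight :: "nat list \<Rightarrow> 'k::field" where
  "tail_sum_weight rs = (\<Prod>j=1..length rs. 1 / of_nat (sum_list (drop (j - 1) rs)))"

lemma tail_sum_weight_Nil: "tail_sum_weight [] = 1"
  by (simp add: tail_sum_weight_def)

lemma tail_sum_weight_Cons:
  "tail_sum_weight (r # rs) = 1 / of_nat (sum_list (r # rs)) * tail_sum_weight rs"
proof -
  have "tail_sum_weight (r # rs)
      = 1 / of_nat (sum_list (r # rs))
        * (\<Prod>j=Suc 1..Suc (length rs). 1 / of_nat (sum_list (drop (j - 1) (r # rs))) :: 'a)"
    unfolding tail_sum_weight_def by (subst prod.atLeast_Suc_atMost) auto
  also have "(\<Prod>j=Suc 1..Suc (length rs). 1 / of_nat (sum_list (drop (j - 1) (r # rs))) :: 'a)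
      = tail_sum_weight rs"
    unfolding tail_sum_weight_def prod.atLeast_Suc_atMost_Suc_shift
    by (intro prod.cong) (auto simp: drop_Cons')
  finally show ?thesis .
qed


section \<open>Sums over triangles\<close>

text \<open>Both sides run over all \<open>(k, j, n - k - j)\<close>, the triples of naturals with sum \<open>n\<close> and \<open>k\<close> positive.\<close>

lemma sum_triangle_swap:
  fixes T :: "nat \<Rightarrow> nat \<Rightarrow> 'a::comm_monoid_add"
  shows "(\<Sum>k=1..n. \<Sum>j=0..n-k. T k j) = (\<Sum>j=0..n. \<Sum>k=1..n-j. T k j)"
proof -
  have "(\<Sum>k=1..n. \<Sum>j=0..n-k. T k j) = (\<Sum>k=1..n. \<Sum>j\<in>{j\<in>{0..n}. k + j \<le> n}. T k j)"
    by (intro sum.cong) auto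
  also have "\<dots> = (\<Sum>j=0..n. \<Sum>k\<in>{k\<in>{1..n}. k + j \<le> n}. T k j)"
    by (rule sum.swap_restrict) auto
  also have "\<dots> = (\<Sum>j=0..n. \<Sum>k=1..n-j. T k j)"
    by (intro sum.cong) auto
  finally show ?thesis .
qed

lemma sum_antidiagonal_swap:
  fixes T :: "nat \<Rightarrow> nat \<Rightarrow> 'a::comm_monoid_add"
  shows "(\<Sum>j=0..n. T (n - j) j) = (\<Sum>i=0..n. T i (n - i))"
  by (rule sum.reindex_bij_witness[where i = "\<lambda>i. n - i" and j = "\<lambda>j. n - j"]) auto


section \<open>The logarithmic derivative of a sequence of maps\<close>

locale char_0_algebra = algebra_over_field scale
  for scale :: "'k::field_char_0 \<Rightarrow> 'a::ring \<Rightarrow> 'a" (infixr \<open>*s\<close> 75)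
begin

text \<open>
  The recursion \<open>n f\<^sub>n = \<Sum>k=1..n. F\<^sub>k f\<^bsub>n-k\<^esub>\<close> with \<open>f\<^sub>0 = id\<close>, solved for its last term
  \<open>F\<^sub>n\<close>; at \<open>n = 0\<close> it gives the zero map.
\<close>

fun log_derivative :: "(nat \<Rightarrow> 'a \<Rightarrow> 'a) \<Rightarrow> nat \<Rightarrow> 'a \<Rightarrow> 'a" where
  "log_derivative f n x
     = of_nat n *s f n x - (\<Sum>k\<in>{1..<n}. log_derivative f k (f (n - k) x))"

declare log_derivative.simps [simp del]

lemma log_derivative_rec:
  assumes "f 0 = id"
  shows "of_nat n *s f n x = (\<Sum>k=1..n. log_derivative f k (f (n - k) x))"
proof (cases "n = 0")
  case False
  then have "{1..n} = insert n {1..<n}" by auto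
  then show ?thesis
    using assms log_derivative.simps[of f n x] by simp
qed simp

lemma linear_log_derivative:
  assumes "\<And>n. Vector_Spaces.linear scale scale (f n)"
  shows "Vector_Spaces.linear scale scale (log_derivative f n)"
proof (induction n rule: less_induct)
  case (less n)
  interpret P: vector_space_pair scale scale ..
  have "Vector_Spaces.linear scale scale (\<lambda>x. log_derivative f k (f (n - k) x))"
    if "k \<in> {1..<n}" for k
    using Vector_Spaces.linear_compose[OF assms less, of k "n - k"] that by (simp add: o_def)
  then have "Vector_Spaces.linear scale scale
      (\<lambda>x. of_nat n *s f n x - (\<Sum>k\<in>{1..<n}. log_derivative f k (f (n - k) x)))"
    by (intro P.linear_compose_sub P.linear_compose_scale_right P.linear_compose_sum assms) auto
  moreover have "log_derivative f n
      = (\<lambda>x. of_nat n *s f n x - (\<Sum>k\<in>{1..<n}. log_derivative f k (f (n - k) x)))"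
    by (rule ext) (rule log_derivative.simps)
  ultimately show ?case
    by simp
qed

text \<open>
  The defect \<open>E k a b\<close> measures the failure of the derivation rule for \<open>F\<^sub>k\<close>. The Leibniz rule
  for \<open>t d/dt\<close> says that the sum of \<open>E k (g\<^sub>i a) (h\<^sub>j b)\<close> over \<open>k + i + j = n\<close> vanishes. By
  induction only \<open>k = n\<close> survives in it, and that term is \<open>E n a b\<close>.
\<close>

lemma log_derivative_leibniz:
  assumes lin: "\<And>n. Vector_Spaces.linear scale scale (f n)"
    and prod: "\<And>n a b. f n (a * b) = (\<Sum>k=0..n. g (n - k) a * h k b)"
    and id: "f 0 = id" "g 0 = id" "h 0 = id"
    and n: "n \<ge> 1"
  shows "log_derivative f n (a * b) = log_derivative g n a * b + a * log_derivative h n b"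
  using n
proof (induction n arbitrary: a b rule: less_induct)
  case (less n)
  let ?F = "log_derivative f" and ?G = "log_derivative g" and ?H = "log_derivative h"
  interpret P: vector_space_pair scale scale ..
  define E where "E k a b = ?F k (a * b) - ?G k a * b - a * ?H k b" for k a b
  have sum_F: "(\<Sum>k=1..n. \<Sum>j=0..n-k. ?F k (g (n - k - j) a * h j b)) = of_nat n *s f n (a * b)"
    unfolding log_derivative_rec[where f = f, OF id(1)]
    by (simp add: prod P.linear_sum[OF linear_log_derivative[OF lin]])
  have sum_G: "(\<Sum>k=1..n. \<Sum>j=0..n-k. ?G k (g (n - k - j) a) * h j b)
      = (\<Sum>j=0..n. (of_nat (n - j) *s g (n - j) a) * h j b)"
    unfolding sum_triangle_swap
      log_derivative_rec[where f = g, OF id(2)]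
    by (simp add: sum_distrib_right add.commute)
  \<comment> \<open>The recursion for \<open>h\<close> needs \<open>g\<^sub>i a\<close> fixed in the inner sum, so the summation index is
    changed to \<open>i = n - k - j\<close> and changed back at the end.\<close>
  have "(\<Sum>k=1..n. \<Sum>j=0..n-k. g (n - k - j) a * ?H k (h j b))
      = (\<Sum>k=1..n. \<Sum>i=0..n-k. g i a * ?H k (h (n - k - i) b))"
    by (rule sum.cong[OF refl], rule sum_antidiagonal_swap[where T = "\<lambda>i j. g i a * ?H _ (h j b)"])
  also have "\<dots> = (\<Sum>i=0..n. g i a * (of_nat (n - i) *s h (n - i) b))"
    unfolding sum_triangle_swap
      log_derivative_rec[where f = h, OF id(3)]
    by (simp add: sum_distrib_left add.commute)
  also have "\<dots> = (\<Sum>j=0..n. g (n - j) a * (of_nat j *s h j b))"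
    by (rule sum_antidiagonal_swap[where T = "\<lambda>i j. g i a * (of_nat j *s h j b)", symmetric])
  finally have sum_H: "(\<Sum>k=1..n. \<Sum>j=0..n-k. g (n - k - j) a * ?H k (h j b))
      = (\<Sum>j=0..n. g (n - j) a * (of_nat j *s h j b))" .
  have "of_nat n *s f n (a * b) = (\<Sum>j=0..n. of_nat n *s (g (n - j) a * h j b))"
    by (simp add: prod scale_sum_right)
  also have "\<dots> = (\<Sum>j=0..n. (of_nat (n - j) *s g (n - j) a) * h j b
                             + g (n - j) a * (of_nat j *s h j b))"
    by (intro sum.cong)
       (auto simp: mult_scale_left mult_scale_right scale_left_distrib[symmetric]
             simp flip: of_nat_add)
  finally have "(\<Sum>k=1..n. \<Sum>j=0..n-k. E k (g (n - k - j) a) (h j b)) = 0"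
    unfolding E_def sum_subtractf sum_F sum_G sum_H sum.distrib by simp
  moreover have "(\<Sum>j=0..n-k. E k (g (n - k - j) a) (h j b)) = (if k = n then E n a b else 0)"
    if "k \<in> {1..n}" for k
    using that less.IH[of k] id by (auto simp: E_def)
  ultimately have "E n a b = 0"
    using less.prems by simp
  then show ?case
    by (simp add: E_def algebra_simps)
qed


section \<open>Recovering a sequence from its logarithmic derivative\<close>

definition composition_sum :: "(nat \<Rightarrow> 'a \<Rightarrow> 'a) \<Rightarrow> nat \<Rightarrow> 'a \<Rightarrow> 'a" where
  "composition_sum D n x
     = (\<Sum>rs\<in>compositions n. tail_sum_weight rs *s foldr (\<circ>) (map D rs) id x)"

text \<open>
  The two sums differ only at \<open>n = 0\<close>, where \<open>composition_sum\<close> contains the empty composition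
  and is the identity. This is the initial value that the recursion for it needs.
\<close>

lemma weighted_composition_sum_eq:
  assumes "n \<ge> 1"
  shows "weighted_composition_sum scale D n x = composition_sum D n x"
proof -
  have "positive_tuples 0 n = {}"
    using assms by (auto simp: positive_tuples_def)
  moreover have "{0..n} = insert 0 {1..n}" by auto
  ultimately have "compositions n = (\<Union>i\<in>{1..n}. positive_tuples i n)"
    by (simp add: compositions_eq_positive_tuples)
  then have "composition_sum D n x
      = (\<Sum>i=1..n. \<Sum>rs\<in>positive_tuples i n. tail_sum_weight rs *s foldr (\<circ>) (map D rs) id x)"
    unfolding composition_sum_def
    by (simp only:, subst sum.UNION_disjoint)
       (auto simp: finite_positive_tuples, auto simp: positive_tuples_def)
  then show ?thesis
    unfolding weighted_composition_sum_def
    by (simp add: tail_sum_weight_def positive_tuples_def)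
qed

lemma composition_sum_0: "composition_sum D 0 = id"
  by (simp add: composition_sum_def compositions_0 tail_sum_weight_Nil fun_eq_iff)

lemma composition_sum_rec:
  assumes lin: "\<And>k. Vector_Spaces.linear scale scale (D k)" and n: "n \<ge> 1"
  shows "of_nat n *s composition_sum D n x = (\<Sum>k=1..n. D k (composition_sum D (n - k) x))"
proof -
  interpret P: vector_space_pair scale scale ..
  have "of_nat n *s (tail_sum_weight (k # rs) *s foldr (\<circ>) (map D (k # rs)) id x)
      = D k (tail_sum_weight rs *s foldr (\<circ>) (map D rs) id x)"
    if "k \<in> {1..n}" "rs \<in> compositions (n - k)" for k rs
  proof -
    have "sum_list (k # rs) = n"
      using that by (auto simp: compositions_def)
    then have "of_nat n * tail_sum_weight (k # rs) = (tail_sum_weight rs :: 'k)"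
      using n unfolding tail_sum_weight_Cons by simp
    then show ?thesis
      by (simp add: P.linear_scale[OF lin])
  qed
  then show ?thesis
    by (simp add: composition_sum_def sum_compositions_Cons[OF n] scale_sum_right
          P.linear_sum[OF lin])
qed

lemma composition_sum_log_derivative:
  assumes lin: "\<And>n. Vector_Spaces.linear scale scale (f n)" and "f 0 = id"
  shows "composition_sum (log_derivative f) n = f n"
proof (induction n rule: less_induct)
  case (less n)
  show ?case
  proof (cases "n = 0")
    case True
    then show ?thesis
      using assms by (simp add: composition_sum_0)
  next
    case False
    have "of_nat n *s composition_sum (log_derivative f) n x = of_nat n *s f n x" for x
      using False less
      by (simp add: composition_sum_rec[OF linear_log_derivative[OF lin]]
            log_derivative_rec[where f = f, OF \<open>f 0 = id\<close>])
    then show ?thesis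
      using False by (auto simp: fun_eq_iff)
  qed
qed

end


section \<open>Higher derivations in terms of derivations\<close>

theorem theorem2p4:
  fixes scale :: "'k::field_char_0 \<Rightarrow> 'a::ring \<Rightarrow> 'a"
    and f g h :: "nat \<Rightarrow> 'a \<Rightarrow> 'a"
  assumes "algebra_over_field scale"
    and "higher_gh_derivation scale g h f"
    and "f 0 = id" and "g 0 = id" and "h 0 = id"
  shows "\<exists>F G H :: nat \<Rightarrow> 'a \<Rightarrow> 'a.
           (\<forall>n\<ge>1. gh_derivation scale (G n) (H n) (F n)) \<and>
           (\<forall>n\<ge>1. f n = weighted_composition_sum scale F n \<and>
                  g n = weighted_composition_sum scale G n \<and>
                  h n = weighted_composition_sum scale H n)"
proof -
  interpret char_0_algebra scale
    using assms(1) by (simp add: char_0_algebra_def)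
  note id = assms(3-5)
  have lin: "Vector_Spaces.linear scale scale (f n)" "Vector_Spaces.linear scale scale (g n)"
      "Vector_Spaces.linear scale scale (h n)" for n
    using assms(2) by (auto simp: higher_gh_derivation_def)
  have gh: "f n (a * b) = (\<Sum>k=0..n. g (n - k) a * h k b)"
    and hg: "f n (a * b) = (\<Sum>k=0..n. h (n - k) a * g k b)" for n a b
    using assms(2) unfolding higher_gh_derivation_def by blast+
  have "gh_derivation scale (log_derivative g n) (log_derivative h n) (log_derivative f n)"
    if "n \<ge> 1" for n
    unfolding gh_derivation_def
    using linear_log_derivative[of f, OF lin(1)] linear_log_derivative[of g, OF lin(2)]
      linear_log_derivative[of h, OF lin(3)]
      log_derivative_leibniz[OF lin(1) gh id that]
      log_derivative_leibniz[OF lin(1) hg id(1,3,2) that]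
    by blast
  moreover have "d n = weighted_composition_sum scale (log_derivative d) n"
    if "n \<ge> 1" "\<And>m. Vector_Spaces.linear scale scale (d m)" "d 0 = id" for d n
    using composition_sum_log_derivative[of d n] that
    by (simp add: weighted_composition_sum_eq fun_eq_iff)
  ultimately show ?thesis
    using lin id by blast
qed

end
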